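(* The map $\mathcal{H}$ sends every $f\in\mathcal{F}_d(p)$ (with rational entries) to a polynomial of the form $\sum_{\alpha\in\{0,1\}^{d-1}}a_\alpha x^\alpha\in\mathbb{Q}[x_1,\ldots,x_{d-1}]$ that belongs to the ideal $\mathcal{I}_{\mathcal{P}}\subseteq \mathbb{Q}[x_1,\ldots,x_{d-1}]$ of all polynomials vanishing at every point of $\mathcal{P}=\{\mathbf{1}_{d-1},\,c_1,\ldots,c_{d-1}\}$, where $\mathbf{1}_{d-1}=(1,\ldots,1)$ and $c_j=(1,\ldots,1,-c,1,\ldots,1)$ with $-c$ in position $j$.
   Context: Let $d\ge 2$, $D=2^d$, and let $p=s/t\in\mathbb{Q}$ with positive integers $s,t$ and $0<p\le 1/2$; put $q=1-p$ and $c=q/p=(t-s)/s$. $\mathcal{F}_d(p)$ is the set of probability mass functions (pmfs) on $\{0,1\}^d$ all of whose $d$ univariate marginals are Bernoulli with parameter $p$. A pmf is identified with the column vector $f=(f_1,\ldots,f_D)$, where $f_i$ is the probability of the point $(x_1,\ldots,x_d)\in\{0,1\}^d$ with $i=1+\sum_{k=1}^d x_k2^{k-1}$. For $1\le j\le D/2$ let $m_j(x)=\prod_{k=1}^{d-1}x_k^{\varepsilon_k}$, where $\varepsilon_k\in\{0,1\}$ are determined by $j=1+\sum_{k=1}^{d-1}\varepsilon_k2^{k-1}$ (so $m_1=1,\ m_2=x_1,\ m_3=x_2,\ m_4=x_1x_2,\ldots$). Let $m(x)$ be the row vector of length $D$ $$m(x)=\Big(m_1(x),\ldots,m_{D/2}(x),\,-m_{D/2}(x)+\tfrac{2s-t}{s},\ldots,-m_1(x)+\tfrac{2s-t}{s}\Big).$$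 The map $\mathcal{H}$ is defined by $\mathcal{H}(f)=P_f(x)=m(x)f\in\mathbb{Q}[x_1,\ldots,x_{d-1}]$. For $\alpha\in\{0,1\}^{d-1}$, $x^\alpha=x_1^{\alpha_1}\cdots x_{d-1}^{\alpha_{d-1}}$. *)

theory Defs
  imports "HOL-Probability.Probability_Mass_Function" "HOL-Library.Poly_Mapping"
    "HOL-Library.FuncSet"
begin

(* Points of {0,1}^n are the extensional functions {1..n} -> {0,1}. *)
definition cube :: "nat \<Rightarrow> (nat \<Rightarrow> nat) set" where
  "cube n = {1..n} \<rightarrow>\<^sub>E {0, 1}"

definition cube_index :: "nat \<Rightarrow> (nat \<Rightarrow> nat) \<Rightarrow> nat" where
  "cube_index n x = 1 + (\<Sum>k=1..n. x k * 2 ^ (k - 1))"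

(* Inverse of the binary enumeration cube_index n : {0,1}^n -> {1..2^n}. *)
definition cube_point :: "nat \<Rightarrow> nat \<Rightarrow> (nat \<Rightarrow> nat)" where
  "cube_point n = inv_into (cube n) (cube_index n)"

definition bernoulli_class :: "nat \<Rightarrow> real \<Rightarrow> (nat \<Rightarrow> nat) pmf set" where
  "bernoulli_class d p = {F. set_pmf F \<subseteq> cube d \<and>
     (\<forall>k\<in>{1..d}. map_pmf (\<lambda>x. x k) F = map_pmf of_bool (bernoulli_pmf p))}"

(* The column vector (f_1, ..., f_D) of F with entries read as rational numbers;
   only meaningful when all values of F are rational. *)
definition pmf_vector :: "nat \<Rightarrow> (nat \<Rightarrow> nat) pmf \<Rightarrow> nat \<Rightarrow> rat" where
  "pmf_vector d F i = inv (of_rat :: rat \<Rightarrow> real) (pmf F (cube_point d i))"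

(* Polynomials over Q in the indeterminates X 0, X 1, ...: a finitely supported map from
   exponent vectors to coefficients, with the convolution product of Poly_Mapping. *)
type_synonym mpoly = "(nat \<Rightarrow>\<^sub>0 nat) \<Rightarrow>\<^sub>0 rat"

definition Const :: "rat \<Rightarrow> mpoly" where
  "Const a = Poly_Mapping.single 0 a"

definition X :: "nat \<Rightarrow> mpoly" where
  "X k = Poly_Mapping.single (Poly_Mapping.single k 1) 1"

(* Q[x_1, ..., x_n] *)
definition polys :: "nat \<Rightarrow> mpoly set" where
  "polys n = {P. \<forall>u\<in>Poly_Mapping.keys P. Poly_Mapping.keys u \<subseteq> {1..n}}"

definition eval_mpoly :: "(nat \<Rightarrow> rat) \<Rightarrow> mpoly \<Rightarrow> rat" where
  "eval_mpoly z P = (\<Sum>u\<in>Poly_Mapping.keys P. Poly_Mapping.lookup P u *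
     (\<Prod>k\<in>Poly_Mapping.keys u. z k ^ Poly_Mapping.lookup u k))"

definition vanishing_ideal :: "nat \<Rightarrow> (nat \<Rightarrow> rat) set \<Rightarrow> mpoly set" where
  "vanishing_ideal n S = {P \<in> polys n. \<forall>z\<in>S. eval_mpoly z P = 0}"

(* x^alpha in n variables *)
definition monomial :: "nat \<Rightarrow> (nat \<Rightarrow> nat) \<Rightarrow> mpoly" where
  "monomial n \<alpha> = (\<Prod>k=1..n. X k ^ \<alpha> k)"

definition m_mon :: "nat \<Rightarrow> nat \<Rightarrow> mpoly" where
  "m_mon d j = monomial (d - 1) (cube_point (d - 1) j)"

definition m_vec :: "nat \<Rightarrow> nat \<Rightarrow> nat \<Rightarrow> nat \<Rightarrow> mpoly" where
  "m_vec d s t i =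
     (if i \<le> 2 ^ d div 2 then m_mon d i
      else - m_mon d (2 ^ d + 1 - i) + Const ((2 * of_nat s - of_nat t) / of_nat s))"

definition H_map :: "nat \<Rightarrow> nat \<Rightarrow> nat \<Rightarrow> (nat \<Rightarrow> rat) \<Rightarrow> mpoly" where
  "H_map d s t f = (\<Sum>i=1..2 ^ d. m_vec d s t i * Const (f i))"

definition one_point :: "nat \<Rightarrow> nat \<Rightarrow> rat" where
  "one_point n = (\<lambda>k\<in>{1..n}. 1)"

definition c_point :: "nat \<Rightarrow> rat \<Rightarrow> nat \<Rightarrow> nat \<Rightarrow> rat" where
  "c_point n c j = (\<lambda>k\<in>{1..n}. if k = j then - c else 1)"

definition P_points :: "nat \<Rightarrow> rat \<Rightarrow> (nat \<Rightarrow> rat) set" where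
  "P_points n c = insert (one_point n) (c_point n c ` {1..n})"

end

(* Index the entries of f by the points x of {0,1}^d.  If x_d = 0 the x-th entry of m is x^alpha
   with alpha = (x_1, ..., x_{d-1}); if x_d = 1, reading the second half of m backwards complements
   alpha, and the entry is -x^(1 - alpha) + (1 - c), since (2 s - t) / s = 1 - c.  At 1_{d-1} this
   entry equals 1 or -c according to x_d = 0 or 1, and at c_j it equals 1 or -c according to
   x_j = 0 or 1.  Hence P_f takes there the value q - c p = 0 by the marginal conditions. *)
theory Submission
  imports Defs
begin

section \<open>Binary enumeration of the cube\<close>

lemma cube_index_Suc: "cube_index (Suc n) x = cube_index n x + x (Suc n) * 2 ^ n"
  by (simp add: cube_index_def)

lemma cube_index_cong:
  assumes "\<And>k. k \<in> {1..n} \<Longrightarrow> x k = y k"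
  shows "cube_index n x = cube_index n y"
  unfolding cube_index_def using assms by (intro arg_cong2[where f = "(+)"] sum.cong) auto

lemma cube_index_ge_1: "1 \<le> cube_index n x"
  by (simp add: cube_index_def)

lemma cube_index_le:
  assumes "\<And>k. k \<in> {1..n} \<Longrightarrow> x k \<le> 1"
  shows "cube_index n x \<le> 2 ^ n"
  using assms
proof (induction n)
  case 0
  then show ?case by (simp add: cube_index_def)
next
  case (Suc n)
  have "cube_index n x \<le> 2 ^ n" using Suc by simp
  moreover have "x (Suc n) = 0 \<or> x (Suc n) = 1" using Suc.prems[of "Suc n"] by auto
  ultimately show ?case by (auto simp: cube_index_Suc)
qed

text \<open>The digits of \<open>x\<close> and of its complement add up to 1 in every place, so the
  two digit sums add up to 2^n - 1; the remaining 2 comes from the offset 1 in each index. This is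
  what turns reading the second half of the row vector backwards into complementing
  exponents.\<close>

lemma cube_index_complement:
  assumes "\<And>k. k \<in> {1..n} \<Longrightarrow> x k \<le> 1"
  shows "cube_index n x + cube_index n (\<lambda>k. 1 - x k) = 2 ^ n + 1"
  using assms
proof (induction n)
  case 0
  then show ?case by (simp add: cube_index_def)
next
  case (Suc n)
  have "x (Suc n) = 0 \<or> x (Suc n) = 1" using Suc.prems[of "Suc n"] by auto
  then show ?case using Suc by (auto simp: cube_index_Suc)
qed

text \<open>Uniqueness of binary digits, from the top down: the lower digits give an index between 1
  and 2^n, so equal indices force equal top digits, and these can then be cancelled.\<close>

lemma cube_index_eq_imp_eq:
  assumes "\<And>k. k \<in> {1..n} \<Longrightarrow> x k \<le> 1" "\<And>k. k \<in> {1..n} \<Longrightarrow> y k \<le> 1"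
    and "cube_index n x = cube_index n y" and "k \<in> {1..n}"
  shows "x k = y k"
  using assms
proof (induction n)
  case 0
  then show ?case by simp
next
  case (Suc n)
  have bounds: "1 \<le> cube_index n x" "cube_index n x \<le> 2 ^ n"
    "1 \<le> cube_index n y" "cube_index n y \<le> 2 ^ n"
    by (intro cube_index_ge_1 cube_index_le Suc.prems; simp)+
  have eq: "cube_index n x + x (Suc n) * 2 ^ n = cube_index n y + y (Suc n) * 2 ^ n"
    using Suc.prems(3) by (simp add: cube_index_Suc)
  have last_values: "x (Suc n) = 0 \<or> x (Suc n) = 1" "y (Suc n) = 0 \<or> y (Suc n) = 1"
    using Suc.prems(1)[of "Suc n"] Suc.prems(2)[of "Suc n"] by auto
  have last: "x (Suc n) = y (Suc n)"
    using last_values eq bounds by auto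
  show ?case
  proof (cases "k = Suc n")
    case True
    then show ?thesis using last by simp
  next
    case False
    then show ?thesis using Suc last eq by auto
  qed
qed

lemma cube_le_1: "x \<in> cube n \<Longrightarrow> k \<in> {1..n} \<Longrightarrow> x k \<le> 1"
  by (force simp: cube_def PiE_iff)

lemma finite_cube: "finite (cube n)"
  by (auto simp: cube_def intro!: finite_PiE)

lemma inj_on_cube_index: "inj_on (cube_index n) (cube n)"
proof (rule inj_onI)
  fix x y assume x: "x \<in> cube n" and y: "y \<in> cube n" and eq: "cube_index n x = cube_index n y"
  have "x k = y k" if "k \<in> {1..n}" for k
    using cube_index_eq_imp_eq[OF cube_le_1[OF x] cube_le_1[OF y] eq that] by blast
  then show "x = y"
    using x y unfolding cube_def by (intro PiE_ext)
qed

lemma bij_betw_cube_index: "bij_betw (cube_index n) (cube n) {1..2 ^ n}"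
proof -
  have "cube_index n ` cube n \<subseteq> {1..2 ^ n}"
    using cube_index_ge_1 cube_index_le cube_le_1 by (metis atLeastAtMost_iff image_subsetI)
  \<comment> \<open>Surjectivity by counting: the image lies in a set with the same number 2^n of
    elements.\<close>
  moreover have "card (cube_index n ` cube n) = card {1..2 ^ n :: nat}"
    by (subst card_image[OF inj_on_cube_index])
      (simp add: cube_def card_PiE numeral_2_eq_2[symmetric])
  ultimately show ?thesis
    using inj_on_cube_index card_subset_eq by (metis bij_betw_def finite_atLeastAtMost)
qed

lemma cube_point_cube_index: "x \<in> cube n \<Longrightarrow> cube_point n (cube_index n x) = x"
  by (simp add: cube_point_def inj_on_cube_index)

section \<open>Monomials and evaluation of polynomials\<close>

lemma lookup_sum_single:
  fixes \<alpha> :: "nat \<Rightarrow> nat"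
  assumes "finite A"
  shows "Poly_Mapping.lookup (\<Sum>k\<in>A. Poly_Mapping.single k (\<alpha> k)) j = (if j \<in> A then \<alpha> j else 0)"
  using assms by (simp add: lookup_sum lookup_single when_def)

lemma X_power: "X k ^ e = Poly_Mapping.single (Poly_Mapping.single k e) 1"
  by (induction e) (simp_all add: X_def mult_single single_add[symmetric] add.commute)

lemma prod_single_one:
  fixes u :: "'i \<Rightarrow> nat \<Rightarrow>\<^sub>0 nat"
  shows "(\<Prod>k\<in>A. Poly_Mapping.single (u k) (1 :: rat)) = Poly_Mapping.single (\<Sum>k\<in>A. u k) 1"
  by (induction A rule: infinite_finite_induct) (simp_all add: mult_single)

text \<open>Presents the product as one term with coefficient 1, from which keys, values and
  products with constants can be read off.\<close>

lemma monomial_eq_single: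
  "monomial n \<alpha> = Poly_Mapping.single (\<Sum>k=1..n. Poly_Mapping.single k (\<alpha> k)) 1"
  by (simp add: monomial_def X_power prod_single_one)

lemma monomial_cong:
  assumes "\<And>k. k \<in> {1..n} \<Longrightarrow> \<alpha> k = \<beta> k"
  shows "monomial n \<alpha> = monomial n \<beta>"
  unfolding monomial_def using assms by (intro prod.cong) auto

text \<open>Coefficients outside the support are 0. A common index set for two polynomials makes
  additivity of evaluation immediate, even when terms cancel in the sum.\<close>

lemma eval_mpoly_superset:
  assumes "finite A" "Poly_Mapping.keys P \<subseteq> A"
  shows "eval_mpoly z P = (\<Sum>u\<in>A. Poly_Mapping.lookup P u *
     (\<Prod>k\<in>Poly_Mapping.keys u. z k ^ Poly_Mapping.lookup u k))"
  unfolding eval_mpoly_def using assms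
  by (intro sum.mono_neutral_left) (auto simp: in_keys_iff)

lemma eval_mpoly_add: "eval_mpoly z (P + Q) = eval_mpoly z P + eval_mpoly z Q"
proof -
  let ?A = "Poly_Mapping.keys P \<union> Poly_Mapping.keys Q"
  have "Poly_Mapping.keys (P + Q) \<subseteq> ?A" by (rule Poly_Mapping.keys_add)
  then show ?thesis
    by (simp add: eval_mpoly_superset[of ?A] lookup_add distrib_right sum.distrib)
qed

lemma eval_mpoly_zero: "eval_mpoly z 0 = 0"
  by (simp add: eval_mpoly_def)

lemma eval_mpoly_sum: "eval_mpoly z (\<Sum>i\<in>A. P i) = (\<Sum>i\<in>A. eval_mpoly z (P i))"
  by (induction A rule: infinite_finite_induct) (simp_all add: eval_mpoly_zero eval_mpoly_add)

lemma eval_mpoly_single: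
  "eval_mpoly z (Poly_Mapping.single u a) =
     a * (\<Prod>k\<in>Poly_Mapping.keys u. z k ^ Poly_Mapping.lookup u k)"
  by (subst eval_mpoly_superset[of "{u}"]) auto

lemma eval_mpoly_Const_monomial:
  "eval_mpoly z (Const a * monomial n \<alpha>) = a * (\<Prod>k=1..n. z k ^ \<alpha> k)"
proof -
  let ?u = "\<Sum>k=1..n. Poly_Mapping.single k (\<alpha> k)"
  have "(\<Prod>k\<in>Poly_Mapping.keys ?u. z k ^ Poly_Mapping.lookup ?u k) = (\<Prod>k=1..n. z k ^ \<alpha> k)"
    \<comment> \<open>The keys of \<open>?u\<close> are the k in {1..n} with nonzero exponent; the
      other factors are z k ^ 0 = 1.\<close>
    by (rule prod.mono_neutral_cong_left)
      (auto simp: in_keys_iff lookup_sum_single split: if_splits)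
  then show ?thesis
    by (simp add: monomial_eq_single Const_def mult_single eval_mpoly_single)
qed

lemma Const_add: "Const (a + b) = Const a + Const b"
  by (simp add: Const_def single_add)

lemma Const_mult: "Const (a * b) = Const a * Const b"
  by (simp add: Const_def mult_single)

lemma Const_uminus: "Const (- a) = - Const a"
  by (simp add: Const_def single_uminus)

lemma Const_zero: "Const 0 = 0"
  by (simp add: Const_def)

lemma monomial_zero: "monomial n (\<lambda>_. 0) = 1"
  by (simp add: monomial_def)

section \<open>Polynomials with all exponents at most 1\<close>

definition multilinear :: "nat \<Rightarrow> mpoly \<Rightarrow> bool" where
  "multilinear n P \<longleftrightarrow> (\<exists>a. P = (\<Sum>\<alpha>\<in>cube n. Const (a \<alpha>) * monomial n \<alpha>))"

lemma multilinear_zero: "multilinear n 0"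
  unfolding multilinear_def by (rule exI[of _ "\<lambda>_. 0"]) (simp add: Const_zero)

lemma multilinear_add:
  assumes "multilinear n P" "multilinear n Q"
  shows "multilinear n (P + Q)"
proof -
  obtain a b where "P = (\<Sum>\<alpha>\<in>cube n. Const (a \<alpha>) * monomial n \<alpha>)"
    and "Q = (\<Sum>\<alpha>\<in>cube n. Const (b \<alpha>) * monomial n \<alpha>)"
    using assms unfolding multilinear_def by blast
  then have "P + Q = (\<Sum>\<alpha>\<in>cube n. Const (a \<alpha> + b \<alpha>) * monomial n \<alpha>)"
    by (simp add: Const_add distrib_right sum.distrib)
  then show ?thesis
    unfolding multilinear_def by (intro exI)
qed

lemma multilinear_sum: "(\<And>i. i \<in> A \<Longrightarrow> multilinear n (P i)) \<Longrightarrow> multilinear n (\<Sum>i\<in>A. P i)"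
  by (induction A rule: infinite_finite_induct) (simp_all add: multilinear_zero multilinear_add)

lemma multilinear_Const_monomial:
  assumes "\<And>k. k \<in> {1..n} \<Longrightarrow> \<alpha> k \<le> 1"
  shows "multilinear n (Const a * monomial n \<alpha>)"
proof -
  \<comment> \<open>Points of \<open>cube n\<close> are extensional, whereas \<alpha> may be nonzero
    outside {1..n}, as complemented exponents are. Restricting leaves the monomial unchanged, and
    the coefficient family is then concentrated at \<open>?\<beta>\<close>.\<close>
  let ?\<beta> = "restrict \<alpha> {1..n}"
  have in_cube: "?\<beta> \<in> cube n" using assms by (force simp: cube_def PiE_iff le_Suc_eq)
  have "monomial n \<alpha> = monomial n ?\<beta>" by (rule monomial_cong) simp
  moreover have "(\<Sum>\<gamma>\<in>cube n. Const (if \<gamma> = ?\<beta> then a else 0) * monomial n \<gamma>)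
      = (\<Sum>\<gamma>\<in>cube n. if \<gamma> = ?\<beta> then Const a * monomial n \<gamma> else 0)"
    by (rule sum.cong) (auto simp: Const_zero)
  ultimately have "Const a * monomial n \<alpha> =
      (\<Sum>\<gamma>\<in>cube n. Const (if \<gamma> = ?\<beta> then a else 0) * monomial n \<gamma>)"
    using in_cube finite_cube by simp
  then show ?thesis
    unfolding multilinear_def by (intro exI)
qed

lemma keys_sum_subset: "Poly_Mapping.keys (\<Sum>i\<in>A. P i) \<subseteq> (\<Union>i\<in>A. Poly_Mapping.keys (P i))"
proof (induction A rule: infinite_finite_induct)
  case (insert i A)
  have "Poly_Mapping.keys (P i + (\<Sum>i\<in>A. P i))
      \<subseteq> Poly_Mapping.keys (P i) \<union> Poly_Mapping.keys (\<Sum>i\<in>A. P i)"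
    by (rule Poly_Mapping.keys_add)
  with insert show ?case by auto
qed simp_all

lemma multilinear_imp_polys:
  assumes "multilinear n P"
  shows "P \<in> polys n"
proof -
  obtain a where a: "P = (\<Sum>\<alpha>\<in>cube n. Const (a \<alpha>) * monomial n \<alpha>)"
    using assms unfolding multilinear_def by blast
  have keys: "Poly_Mapping.keys (Const (a \<alpha>) * monomial n \<alpha>)
      \<subseteq> {\<Sum>k=1..n. Poly_Mapping.single k (\<alpha> k)}" for \<alpha>
    by (simp add: monomial_eq_single Const_def mult_single)
  have exponents: "Poly_Mapping.keys (\<Sum>k=1..n. Poly_Mapping.single k (\<alpha> k)) \<subseteq> {1..n}"
    for \<alpha> :: "nat \<Rightarrow> nat"
    by (auto simp: in_keys_iff lookup_sum_single split: if_splits)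
  have "\<exists>\<alpha>. u = (\<Sum>k=1..n. Poly_Mapping.single k (\<alpha> k))" if "u \<in> Poly_Mapping.keys P" for u
    using that keys_sum_subset[of "\<lambda>\<alpha>. Const (a \<alpha>) * monomial n \<alpha>" "cube n"] keys
    unfolding a by blast
  then show ?thesis
    using exponents unfolding polys_def by blast
qed

section \<open>The row vector and the map in cube coordinates\<close>

lemma m_vec_cube_index:
  assumes x: "x \<in> cube (Suc n)"
  shows "m_vec (Suc n) s t (cube_index (Suc n) x) =
    (if x (Suc n) = 0 then monomial n x
     else - monomial n (\<lambda>k. 1 - x k) + Const ((2 * of_nat s - of_nat t) / of_nat s))"
proof -
  have le: "x k \<le> 1" if "k \<in> {1..Suc n}" for k
    using cube_le_1[OF x that] .
  have m_mon: "m_mon (Suc n) (cube_index n y) = monomial n y"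
    if "\<And>k. k \<in> {1..n} \<Longrightarrow> y k \<le> 1" for y
  proof -
    let ?y = "restrict y {1..n}"
    have y: "?y \<in> cube n" using that by (force simp: cube_def PiE_iff le_Suc_eq)
    have "cube_index n y = cube_index n ?y" by (rule cube_index_cong) simp
    then have "cube_point n (cube_index n y) = ?y" using y cube_point_cube_index by simp
    moreover have "monomial n ?y = monomial n y" by (rule monomial_cong) simp
    ultimately show ?thesis by (simp add: m_mon_def)
  qed
  show ?thesis
  proof (cases "x (Suc n) = 0")
    case True
    then show ?thesis
      using cube_index_le[of n x] le m_mon[of x] by (simp add: m_vec_def cube_index_Suc)
  next
    case False
    then have last: "x (Suc n) = 1" using le[of "Suc n"] by simp
    have compl: "cube_index n x + cube_index n (\<lambda>k. 1 - x k) = 2 ^ n + 1"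
      by (rule cube_index_complement) (use le in simp)
    \<comment> \<open>The index of \<open>x\<close> is 2^n + \<open>cube_index n x\<close>, so its
      mirror position is 2^n + 1 - \<open>cube_index n x\<close>, the index of the
      complement.\<close>
    have "2 ^ Suc n + 1 - cube_index (Suc n) x = cube_index n (\<lambda>k. 1 - x k)"
      using compl last by (simp add: cube_index_Suc)
    \<comment> \<open>The inequality is strict because indices start at 1: top digit 1 gives an
      index of at least 2^n + 1.\<close>
    moreover have "\<not> cube_index (Suc n) x \<le> 2 ^ Suc n div 2"
      using last cube_index_ge_1[of n x] by (simp add: cube_index_Suc)
    ultimately show ?thesis
      using last m_mon[of "\<lambda>k. 1 - x k"] by (simp add: m_vec_def)
  qed
qed

text \<open>The additive constant of the second half is carried as a multiple of
  \<open>monomial n (\<lambda>_. 0)\<close>, which is 1. Every summand is thus built from terms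
  \<open>Const a * monomial n \<alpha>\<close> with exponents at most 1, and both the shape of the
  polynomial and its values reduce to facts about such terms.\<close>

lemma H_map_Suc:
  "H_map (Suc n) s t f = (\<Sum>x\<in>cube (Suc n).
     if x (Suc n) = 0 then Const (f (cube_index (Suc n) x)) * monomial n x
     else Const (- f (cube_index (Suc n) x)) * monomial n (\<lambda>k. 1 - x k) +
       Const ((2 * of_nat s - of_nat t) / of_nat s * f (cube_index (Suc n) x)) *
         monomial n (\<lambda>_. 0))"
proof -
  have "H_map (Suc n) s t f = (\<Sum>x\<in>cube (Suc n).
      m_vec (Suc n) s t (cube_index (Suc n) x) * Const (f (cube_index (Suc n) x)))"
    unfolding H_map_def by (rule sum.reindex_bij_betw[OF bij_betw_cube_index, symmetric])
  also have "\<dots> = (\<Sum>x\<in>cube (Suc n).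
     if x (Suc n) = 0 then Const (f (cube_index (Suc n) x)) * monomial n x
     else Const (- f (cube_index (Suc n) x)) * monomial n (\<lambda>k. 1 - x k) +
       Const ((2 * of_nat s - of_nat t) / of_nat s * f (cube_index (Suc n) x)) *
         monomial n (\<lambda>_. 0))"
    by (rule sum.cong)
      (auto simp: m_vec_cube_index Const_mult Const_uminus monomial_zero distrib_right
          right_diff_distrib mult.commute
        simp del: times_divide_eq_left times_divide_eq_right)
  finally show ?thesis .
qed

lemma multilinear_H_map: "multilinear n (H_map (Suc n) s t f)"
  unfolding H_map_Suc
proof (intro multilinear_sum)
  fix x assume x: "x \<in> cube (Suc n)"
  have le: "x k \<le> 1" if "k \<in> {1..n}" for k
    using cube_le_1[OF x] that by simp
  show "multilinear n (if x (Suc n) = 0 then Const (f (cube_index (Suc n) x)) * monomial n x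
     else Const (- f (cube_index (Suc n) x)) * monomial n (\<lambda>k. 1 - x k) +
       Const ((2 * of_nat s - of_nat t) / of_nat s * f (cube_index (Suc n) x)) *
         monomial n (\<lambda>_. 0))"
    using le by (auto intro!: multilinear_add multilinear_Const_monomial)
qed

lemma eval_mpoly_H_map:
  "eval_mpoly z (H_map (Suc n) s t f) = (\<Sum>x\<in>cube (Suc n). f (cube_index (Suc n) x) *
     (if x (Suc n) = 0 then \<Prod>k=1..n. z k ^ x k
      else (2 * of_nat s - of_nat t) / of_nat s - (\<Prod>k=1..n. z k ^ (1 - x k))))"
  unfolding H_map_Suc eval_mpoly_sum
  by (rule sum.cong)
    (simp_all add: eval_mpoly_add eval_mpoly_Const_monomial left_diff_distrib mult.commute[of "f _"]
      del: times_divide_eq_left times_divide_eq_right)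

section \<open>Monomials at the points of \<open>P_points\<close>\<close>

lemma prod_one_point: "(\<Prod>k=1..n. one_point n k ^ e k) = 1"
  by (intro prod.neutral) (simp add: one_point_def)

lemma prod_c_point:
  assumes "j \<in> {1..n}"
  shows "(\<Prod>k=1..n. c_point n c j k ^ e k) = (- c) ^ e j"
proof -
  have "(\<Prod>k=1..n. c_point n c j k ^ e k) = (\<Prod>k=1..n. if k = j then (- c) ^ e k else 1)"
    by (rule prod.cong) (auto simp: c_point_def)
  then show ?thesis using assms by simp
qed

section \<open>Marginal conditions, used through the coordinate means\<close>

lemma bernoulli_class_mean:
  assumes F: "F \<in> bernoulli_class d p" and k: "k \<in> {1..d}" and p: "0 \<le> p" "p \<le> 1"
  shows "(\<Sum>x\<in>cube d. real (x k) * pmf F x) = p"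
proof -
  have "(\<Sum>x\<in>cube d. real (x k) * pmf F x) = measure_pmf.expectation F (\<lambda>x. real (x k))"
    using F by (subst integral_measure_pmf[OF finite_cube[of d]])
      (auto simp: bernoulli_class_def mult.commute)
  also have "\<dots> = measure_pmf.expectation (map_pmf (\<lambda>x. x k) F) real"
    by simp
  also have "map_pmf (\<lambda>x. x k) F = map_pmf of_bool (bernoulli_pmf p)"
    using F k by (simp add: bernoulli_class_def)
  also have "measure_pmf.expectation \<dots> real = p"
    using p by simp
  finally show ?thesis .
qed

text \<open>With c = (1 - p) / p the weight is 1 - (1 + c) x_k. Total mass 1 and mean p turn the sum
  into 1 - (1 + c) p, which vanishes because 1 + c = 1 / p.\<close>

lemma pmf_vector_marginal_balance:
  assumes F: "F \<in> bernoulli_class d (of_rat p)" and rational: "\<forall>x\<in>cube d. pmf F x \<in> \<rat>"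
    and p: "0 < p" "p \<le> 1" and k: "k \<in> {1..d}"
  shows "(\<Sum>x\<in>cube d. pmf_vector d F (cube_index d x) *
           (if x k = 0 then 1 else - ((1 - p) / p))) = 0"
proof -
  let ?c = "(1 - p) / p"
  \<comment> \<open>\<open>inv of_rat\<close> is a right inverse only on the range of
    \<open>of_rat\<close>; the rationality assumption places every \<open>pmf F x\<close>
    there.\<close>
  have vector: "of_rat (pmf_vector d F (cube_index d x)) = pmf F x" if "x \<in> cube d" for x
    using that rational
    by (auto simp: pmf_vector_def cube_point_cube_index Rats_def intro!: f_inv_into_f)
  have total: "(\<Sum>x\<in>cube d. pmf F x) = 1"
    using F by (intro sum_pmf_eq_1 finite_cube) (auto simp: bernoulli_class_def)
  have mean: "(\<Sum>x\<in>cube d. real (x k) * pmf F x) = of_rat p"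
    using F k p by (intro bernoulli_class_mean) auto
  \<comment> \<open>The entries are rational but the mass and mean identities are real, so the sum
    is computed in the reals and its vanishing is pulled back along the injective
    \<open>of_rat\<close>.\<close>
  have "of_rat (\<Sum>x\<in>cube d. pmf_vector d F (cube_index d x) * (if x k = 0 then 1 else - ?c))
      = (\<Sum>x\<in>cube d. pmf F x - of_rat (1 + ?c) * (real (x k) * pmf F x))"
    unfolding of_rat_sum
  proof (rule sum.cong[OF refl])
    fix x assume x: "x \<in> cube d"
    have "x k = 0 \<or> x k = 1" using cube_le_1[OF x k] by auto
    then show "of_rat (pmf_vector d F (cube_index d x) * (if x k = 0 then 1 else - ?c))
        = pmf F x - of_rat (1 + ?c) * (real (x k) * pmf F x)"
      by (auto simp: of_rat_mult vector[OF x] of_rat_add of_rat_minus algebra_simps)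
  qed
  also have "\<dots> = 1 - of_rat (1 + ?c) * of_rat p"
    by (simp only: sum_subtractf sum_distrib_left[symmetric] total mean)
  also have "\<dots> = of_rat (1 - (1 + ?c) * p)"
    by (simp add: of_rat_diff of_rat_mult)
  also have "(1 + ?c) * p = 1"
    using p by (simp add: field_simps)
  finally show ?thesis by simp
qed

theorem theorem3p1:
  fixes d s t :: nat and p q c :: rat and F :: "(nat \<Rightarrow> nat) pmf"
  assumes "d \<ge> 2" and "s > 0" and "t > 0"
    and "p = of_nat s / of_nat t" and "0 < p" and "p \<le> 1 / 2"
    and "q = 1 - p" and "c = q / p"
    and "F \<in> bernoulli_class d (of_rat p)"
    and "\<forall>x\<in>cube d. pmf F x \<in> \<rat>"
  shows "(\<exists>a :: (nat \<Rightarrow> nat) \<Rightarrow> rat.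
            H_map d s t (pmf_vector d F) =
              (\<Sum>\<alpha>\<in>cube (d - 1). Const (a \<alpha>) * monomial (d - 1) \<alpha>))
         \<and> H_map d s t (pmf_vector d F) \<in> vanishing_ideal (d - 1) (P_points (d - 1) c)"
proof -
  obtain n where d: "d = Suc n"
    using \<open>d \<ge> 2\<close> by (cases d) auto
  let ?H = "H_map d s t (pmf_vector d F)"
  \<comment> \<open>Both sides equal 2 - t / s, since 1 + c = 1 / p = t / s.\<close>
  have shift: "(2 * of_nat s - of_nat t) / of_nat s = 1 - c"
    unfolding assms(4,7,8) using assms(2,3) by (simp add: field_simps)
  have balance: "(\<Sum>x\<in>cube d. pmf_vector d F (cube_index d x) * (if x k = 0 then 1 else - c)) = 0"
    if "k \<in> {1..d}" for k
    unfolding assms(7,8)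
    by (rule pmf_vector_marginal_balance[OF assms(9,10,5) _ that]) (use assms(6) in simp)
  \<comment> \<open>Yields the first conjunct and also membership in \<open>polys n\<close>.\<close>
  have ml: "multilinear n ?H"
    unfolding d by (rule multilinear_H_map)
  \<comment> \<open>Here the last coordinate alone selects the weight, so its marginal is the one
    that counts.\<close>
  have "eval_mpoly (one_point n) ?H = 0"
    using balance[of d] unfolding d eval_mpoly_H_map prod_one_point shift
    by (simp cong: if_cong)
  moreover have "eval_mpoly (c_point n c j) ?H = 0" if j: "j \<in> {1..n}" for j
  proof -
    have "eval_mpoly (c_point n c j) ?H =
        (\<Sum>x\<in>cube d. pmf_vector d F (cube_index d x) * (if x j = 0 then 1 else - c))"
      unfolding d eval_mpoly_H_map prod_c_point[OF j] shift
    proof (rule sum.cong[OF refl])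
      fix x assume "x \<in> cube (Suc n)"
      then have "x j = 0 \<or> x j = 1" using j cube_le_1[of x "Suc n" j] by auto
      \<comment> \<open>The last coordinate drops out: if it is 1, then x_j = 0 gives 1 - c - (-c) =
        1 and x_j = 1 gives 1 - c - 1 = -c, the same values as (-c) ^ x_j.\<close>
      then show "pmf_vector (Suc n) F (cube_index (Suc n) x) *
          (if x (Suc n) = 0 then (- c) ^ x j else 1 - c - (- c) ^ (1 - x j)) =
        pmf_vector (Suc n) F (cube_index (Suc n) x) * (if x j = 0 then 1 else - c)"
        by auto
    qed
    then show ?thesis using balance[of j] j d by simp
  qed
  ultimately have "?H \<in> vanishing_ideal n (P_points n c)"
    using multilinear_imp_polys[OF ml] by (auto simp: vanishing_ideal_def P_points_def)
  then show ?thesis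
    using ml by (simp add: d multilinear_def)
qed

end
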